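(* Let $n\ge 1$ be an integer. Then $$\sum_{i=0}^{n} N^{(0)}_{n,i}\, t^i = \sum_{k=0}^{\lfloor n/2\rfloor} \binom{n}{2k}\binom{2k}{k}\, t^k (1+t)^{n-2k}.$$
   Context: $N^{(0)}_{n,i}=\binom{n}{i}^2$ are the type B Narayana numbers (the $m=0$ case of the $m$-Narayana numbers $N^{(m)}_{n,k}=\binom{2m}{m}\binom{n}{m}^{-1}\binom{n}{k}\binom{n}{k+m}$); $N^{(0)}_{n,i}$ is the number of elements of rank $i$ in the lattice of type B noncrossing partitions of $\{\pm1,\dots,\pm n\}$. *)

theory Defs
  imports Complex_Main "HOL-Computational_Algebra.Polynomial"
begin

(* Rational-valued because of the factor 1 / (n choose m); meaningful for m \<le> n
   (for m > n the division convention 1 / 0 = 0 makes it 0). *)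
definition m_Narayana :: "nat \<Rightarrow> nat \<Rightarrow> nat \<Rightarrow> rat" where
  "m_Narayana m n k =
     of_nat (2 * m choose m) / of_nat (n choose m) * of_nat (n choose k) * of_nat (n choose (k + m))"

lemma m_Narayana_0: "m_Narayana 0 n i = of_nat ((n choose i)\<^sup>2)"
  by (simp add: m_Narayana_def power2_eq_square)

end

theory Submission
  imports Defs
begin

text \<open>Compare coefficients of \<open>t ^ i\<close>: each summand on the right contributes the multinomial
  coefficient \<open>n! / (k! k! (i - k)! (n - i - k)!)\<close>, which also equals
  \<open>(n choose i) (i choose k) (n - i choose k)\<close>; Vandermonde's identity then sums the last two
  factors over \<open>k\<close> to \<open>n choose i\<close>.\<close>

lemma multinomial_regroup:
  fixes n i k :: nat
  assumes "k \<le> i" "i \<le> n" "2 * k \<le> n"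
  shows "(n choose (2 * k)) * (2 * k choose k) * ((n - 2 * k) choose (i - k)) =
         (n choose i) * (i choose k) * ((n - i) choose k)"
\<comment> \<open>If \<open>i + k > n\<close>, both sides vanish through their last factors, since
  \<open>n - 2 * k < i - k\<close> and \<open>n - i < k\<close>. Otherwise \<open>n - i - k\<close>
  is an untruncated difference.\<close>
proof (cases "i + k \<le> n")
  case True
  have "(n choose i) * (i choose k) = (n choose k) * ((n - k) choose (i - k))"
    by (rule choose_mult) (use assms in auto)
  moreover have "(n choose (2 * k)) * (2 * k choose k) = (n choose k) * ((n - k) choose k)"
    using choose_mult[of k "2 * k" n] assms by (simp add: mult_2)
  \<comment> \<open>Passing to the complement puts \<open>n - i\<close> in the lower place, so that
    \<open>choose_mult\<close> can absorb the factor \<open>(n - i) choose k\<close>; a second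
    complement afterwards restores \<open>i - k\<close>.\<close>
  moreover have "((n - k) choose (i - k)) = ((n - k) choose (n - i))"
    using binomial_symmetric[of "i - k" "n - k"] assms by simp
  moreover have "((n - k) choose (n - i)) * ((n - i) choose k) =
      ((n - k) choose k) * ((n - 2 * k) choose (n - i - k))"
    using choose_mult[of k "n - i" "n - k"] assms True by (simp add: mult_2)
  moreover have "((n - 2 * k) choose (n - i - k)) = ((n - 2 * k) choose (i - k))"
  proof -
    have "n - 2 * k - (i - k) = n - i - k"
      using assms by linarith
    with binomial_symmetric[of "i - k" "n - 2 * k"] assms True show ?thesis by simp
  qed
  ultimately show ?thesis
    by (metis mult.assoc)
next
  case False
  with assms show ?thesis by (simp add: binomial_eq_0)
qed

lemma sum_choose_mult_choose_half:
  fixes n i :: nat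
  assumes "i \<le> n"
  shows "(\<Sum>k\<le>n div 2. (i choose k) * ((n - i) choose k)) = n choose i"
proof -
  \<comment> \<open>Either range may be the longer one. A term with \<open>k > n - i\<close> has
    second factor 0; one with \<open>n div 2 < k \<le> n - i\<close> has
    \<open>i \<le> n - k < k\<close>, so its first factor is 0.\<close>
  have "(\<Sum>k\<le>n div 2. (i choose k) * ((n - i) choose k)) =
        (\<Sum>k\<le>n - i. (i choose k) * ((n - i) choose k))"
    by (rule sum.mono_neutral_cong) (auto simp: binomial_eq_0_iff)
  also have "\<dots> = (\<Sum>k\<le>n - i. (i choose k) * ((n - i) choose (n - i - k)))"
    by (rule sum.cong[OF refl]) (metis atMost_iff binomial_symmetric)
  also have "\<dots> = (i + (n - i)) choose (n - i)"
    by (rule vandermonde)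
  also have "\<dots> = n choose i"
    using assms binomial_symmetric[of i n] by simp
  finally show ?thesis .
qed

lemma coeff_one_plus_X_power:
  "coeff ((1 + monom 1 1 :: 'a::comm_semiring_1 poly) ^ m) j = of_nat (m choose j)"
proof -
  have "(1 + monom 1 1 :: 'a poly) ^ m = (\<Sum>l\<le>m. monom (of_nat (m choose l)) l)"
    \<comment> \<open>With the variable as first summand, the index of the binomial sum is its
      exponent.\<close>
    by (subst add.commute, subst binomial_ring)
       (simp add: monom_power of_nat_poly smult_monom)
  then show ?thesis
    by (simp add: coeff_sum binomial_eq_0)
qed

theorem proposition10:
  fixes n :: nat
  assumes "n \<ge> 1"
  defines "t \<equiv> (monom 1 1 :: rat poly)"
  shows "(\<Sum>i=0..n. smult (m_Narayana 0 n i) (t ^ i)) =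
         (\<Sum>k=0..n div 2. smult (of_nat ((n choose (2 * k)) * (2 * k choose k)))
                           (t ^ k * (1 + t) ^ (n - 2 * k)))"
proof (rule poly_eqI)
  fix i
  have "coeff (\<Sum>j=0..n. smult (m_Narayana 0 n j) (t ^ j)) i = of_nat ((n choose i)\<^sup>2)"
    by (simp add: t_def monom_power coeff_sum smult_monom m_Narayana_0 binomial_eq_0)
  also have "(n choose i)\<^sup>2 = (\<Sum>k\<le>n div 2. (n choose i) * (i choose k) * ((n - i) choose k))"
  \<comment> \<open>Coefficients are compared at every \<open>i\<close>; beyond \<open>n\<close> the
    factor \<open>n choose i\<close> kills both sides.\<close>
  proof (cases "i \<le> n")
    case True
    then show ?thesis
      by (simp add: power2_eq_square mult.assoc sum_choose_mult_choose_half
          flip: sum_distrib_left)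
  qed (simp add: binomial_eq_0)
  also have "of_nat \<dots> = coeff (\<Sum>k=0..n div 2. smult (of_nat ((n choose (2 * k)) * (2 * k choose k)))
                           (t ^ k * (1 + t) ^ (n - 2 * k))) i"
    unfolding coeff_sum of_nat_sum atMost_atLeast0
  proof (rule sum.cong[OF refl])
    fix k assume "k \<in> {0..n div 2}"
    then have k: "2 * k \<le> n" by auto
    \<comment> \<open>The conditional is the coefficient shift caused by \<open>t ^ k\<close>. For
      \<open>i < k\<close> the truncated \<open>i - k\<close> is 0 and would give a binomial
      coefficient 1, whereas \<open>i choose k\<close> is 0.\<close>
    have "(n choose i) * (i choose k) * ((n - i) choose k) =
        (n choose (2 * k)) * (2 * k choose k) * (if i < k then 0 else (n - 2 * k) choose (i - k))"
    proof (cases "k \<le> i \<and> i \<le> n")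
      case True
      with multinomial_regroup[of k i n] k show ?thesis by simp
    next
      case False
      with k show ?thesis by (auto simp: binomial_eq_0)
    qed
    then show "of_nat ((n choose i) * (i choose k) * ((n - i) choose k)) =
        coeff (smult (of_nat ((n choose (2 * k)) * (2 * k choose k)))
          (t ^ k * (1 + t) ^ (n - 2 * k))) i"
      by (simp add: t_def monom_power coeff_monom_mult
          coeff_one_plus_X_power[unfolded One_nat_def] flip: of_nat_mult)
  qed
  finally show "coeff (\<Sum>j=0..n. smult (m_Narayana 0 n j) (t ^ j)) i =
      coeff (\<Sum>k=0..n div 2. smult (of_nat ((n choose (2 * k)) * (2 * k choose k)))
        (t ^ k * (1 + t) ^ (n - 2 * k))) i" .
qed

end
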